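(* Let $X$ be a $d$-dimensional multivariate normal vector with mean $0$ and (symmetric positive definite) covariance matrix $\Sigma$, and let $\mathbb{P}(\mathbb{R}_+^d)=\mathbb{P}(X\in\mathbb{R}_+^d)$. Then $$\mathbb{P}(\mathbb{R}_+^d)\le \frac{\exp\left(\frac12\sum_{i=1}^d (\Sigma^{-1})_{ii}\,\mathbb{E}\left[X_i^2 \,\middle|\, X\in\mathbb{R}_+^d\right]\right)}{2^{d-1}e^{d/2}}.$$ In particular, if every diagonal entry of $\Sigma^{-1}$ equals $1$, then $$\mathbb{P}(\mathbb{R}_+^d)\le 2^{-d+1}e^{-d/2}\exp\left(\frac12\mathbb{E}\left[\|X\|_2^2 \,\middle|\, X\in\mathbb{R}_+^d\right]\right).$$
   Context: $\mathbb{R}_+^d=\{x\in\mathbb{R}^d : x_i>0 \text{ for all } i\in[d]\}$ is the positive orthant. $(\Sigma^{-1})_{ii}$ denotes the $i$-th diagonal entry of the inverse covariance matrix. *)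

theory Defs
  imports "HOL-Probability.Probability"
begin

definition positive_orthant :: "(real ^ 'n) set" where
  "positive_orthant = {x. \<forall>i. 0 < x $ i}"

definition sym_pos_def :: "real ^ 'n ^ 'n \<Rightarrow> bool" where
  "sym_pos_def S \<longleftrightarrow> transpose S = S \<and> (\<forall>x. x \<noteq> 0 \<longrightarrow> 0 < x \<bullet> (S *v x))"

definition mvn_density :: "real ^ 'n \<Rightarrow> real ^ 'n ^ 'n \<Rightarrow> real ^ 'n \<Rightarrow> real" where
  "mvn_density \<mu> S x =
     exp (- ((x - \<mu>) \<bullet> (matrix_inv S *v (x - \<mu>))) / 2) / sqrt ((2 * pi) ^ CARD('n) * det S)"

text \<open>The nondegenerate normal law with mean \<open>\<mu>\<close> and covariance matrix \<open>S\<close>.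
  Positive definiteness is part of the definition, since it is what makes the above
  function a probability density.\<close>

definition multivariate_normal ::
    "'a measure \<Rightarrow> ('a \<Rightarrow> real ^ 'n) \<Rightarrow> real ^ 'n \<Rightarrow> real ^ 'n ^ 'n \<Rightarrow> bool" where
  "multivariate_normal M X \<mu> S \<longleftrightarrow>
     sym_pos_def S \<and> distributed M lborel X (\<lambda>x. ennreal (mvn_density \<mu> S x))"

text \<open>Elementary conditional expectation given an event of positive probability
  (junk value if the event is null).\<close>

definition expectation_given :: "'a measure \<Rightarrow> ('a \<Rightarrow> real) \<Rightarrow> 'a set \<Rightarrow> real" where
  "expectation_given M f A = (\<integral>\<omega>. f \<omega> \<partial>uniform_measure M A)"

end

theory Submission
  imports Defs
begin

text \<open>
  Let \<open>A = \<Sigma>\<^sup>-\<^sup>1\<close>, \<open>Q x = x \<bullet> A x\<close> and \<open>D x = \<Sum>\<^sub>i A\<^sub>i\<^sub>i x\<^sub>i\<^sup>2\<close>. Gibbs' inequality, applied to the densities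
  proportional to \<open>exp (- Q / 2)\<close> and \<open>exp (- D / 2)\<close> on the positive orthant, bounds \<open>P\<close> times the exponential of the
  conditional expectation of \<open>(Q - D) / 2\<close> by a quotient of integrals. Here \<open>E[Q | X > 0] = d\<close>, because the orthant
  is a cone: the integral of \<open>exp (- t Q / 2)\<close> over it scales as \<open>t\<close> to the power \<open>- d / 2\<close>, and one differentiates
  at \<open>t = 1\<close>. The orthant carries the fraction \<open>1 / 2\<^sup>d\<close> of the integral of the product function
  \<open>exp (- D / 2)\<close>, and the integral of \<open>exp (- D / 2)\<close> over the whole space is at most that of \<open>exp (- Q / 2)\<close>.
  The latter is Hadamard's determinant inequality, and it follows from Gibbs' inequality again, since
  the mixed moments of the product Gaussian vanish. In fact the bound holds with \<open>2\<^sup>d\<close> in place of \<open>2\<close> to the power \<open>d - 1\<close>.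
\<close>


section \<open>Gibbs' inequality for unnormalised densities\<close>

text \<open>Integrate the tangent bound \<open>exp s \<ge> 1 + s\<close> at
  \<open>s = v - u - c\<close> against \<open>w * exp (c + u)\<close>. This is Jensen's inequality
  for \<open>exp\<close>.\<close>

lemma weighted_gibbs_inequality:
  fixes u v w :: "'a \<Rightarrow> real"
  assumes w: "\<And>x. 0 \<le> w x"
    and u: "integrable N (\<lambda>x. w x * exp (u x))"
    and v: "integrable N (\<lambda>x. w x * exp (v x))"
    and uv: "integrable N (\<lambda>x. w x * exp (u x) * (v x - u x))"
    and pos: "0 < (\<integral>x. w x * exp (u x) \<partial>N)"
  shows "(\<integral>x. w x * exp (u x) \<partial>N) *
           exp ((\<integral>x. w x * exp (u x) * (v x - u x) \<partial>N) / (\<integral>x. w x * exp (u x) \<partial>N))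
         \<le> (\<integral>x. w x * exp (v x) \<partial>N)"
proof -
  define Z where "Z = (\<integral>x. w x * exp (u x) \<partial>N)"
  define I where "I = (\<integral>x. w x * exp (u x) * (v x - u x) \<partial>N)"
  \<comment> \<open>The mean of \<open>v - u\<close> under the probability density
    \<open>w * exp u / Z\<close>. It maximises the lower bound
    \<open>exp c * ((1 - c) * Z + I)\<close>.\<close>
  define c where "c = I / Z"
  have "Z * exp c = exp c * ((1 - c) * Z + I)"
    using pos by (simp add: c_def Z_def[symmetric] field_simps)
  also have "\<dots> = (\<integral>x. exp c * ((1 - c) * (w x * exp (u x)) + w x * exp (u x) * (v x - u x)) \<partial>N)"
    using u uv by (simp add: Z_def I_def)
  also have "\<dots> \<le> (\<integral>x. w x * exp (v x) \<partial>N)"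
  proof (rule integral_mono)
    fix x
    have "exp c * ((1 - c) * (w x * exp (u x)) + w x * exp (u x) * (v x - u x))
        = w x * exp (c + u x) * (1 + (v x - u x - c))"
      by (simp add: exp_add algebra_simps)
    also have "\<dots> \<le> w x * exp (c + u x) * exp (v x - u x - c)"
      by (intro mult_left_mono exp_ge_add_one_self) (simp add: w)
    also have "\<dots> = w x * exp (v x)"
      by (simp add: mult.assoc flip: exp_add)
    finally show "exp c * ((1 - c) * (w x * exp (u x)) + w x * exp (u x) * (v x - u x)) \<le> w x * exp (v x)" .
  qed (use u v uv in auto)
  finally show ?thesis
    by (simp add: c_def Z_def I_def)
qed

section \<open>Dilations and quadratic moments over cones\<close>

lemma nn_integral_scaleR:
  fixes f :: "'a::euclidean_space \<Rightarrow> ennreal"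
  assumes [measurable]: "f \<in> borel_measurable borel" and c: "0 < c"
  shows "(\<integral>\<^sup>+x. f x \<partial>lborel) = ennreal (c ^ DIM('a)) * (\<integral>\<^sup>+x. f (c *\<^sub>R x) \<partial>lborel)"
  using c by (subst lborel_affine[of c 0])
     (simp_all add: nn_integral_density nn_integral_distr nn_integral_cmult ennreal_power)

lemma integrable_scaleR:
  fixes f :: "'a::euclidean_space \<Rightarrow> real"
  assumes f: "integrable lborel f" and c: "0 < c"
  shows "integrable lborel (\<lambda>x. f (c *\<^sub>R x))"
proof -
  have [measurable]: "f \<in> borel_measurable borel"
    using f by auto
  have "(\<integral>\<^sup>+x. ennreal (norm (f x)) \<partial>lborel) < \<infinity>"
    using f by (simp add: integrable_iff_bounded)
  then show ?thesis
    using c by (subst (asm) nn_integral_scaleR[OF _ c]) (auto simp: integrable_iff_bounded ennreal_mult_less_top)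
qed

lemma integral_scaleR:
  fixes f :: "'a::euclidean_space \<Rightarrow> real"
  assumes f: "f \<in> borel_measurable borel" and c: "0 < c"
  shows "(\<integral>x. f x \<partial>lborel) = c ^ DIM('a) * (\<integral>x. f (c *\<^sub>R x) \<partial>lborel)"
  using c f by (subst lborel_affine[of c 0])
     (simp_all add: integral_density integral_distr integrable_distr_eq)

text \<open>The second claim compares the integrals of \<open>w exp (- c\<^sup>2 q / 2)\<close> and \<open>w exp (- q / 2)\<close> by convexity and lets \<open>c\<close>
  tend to \<open>1\<close> from above.\<close>

lemma
  fixes q w :: "'a::euclidean_space \<Rightarrow> real"
  assumes meas [measurable]: "q \<in> borel_measurable borel" "w \<in> borel_measurable borel"
    and q_scale: "\<And>c x. q (c *\<^sub>R x) = c\<^sup>2 * q x" and q_nonneg: "\<And>x. 0 \<le> q x"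
    and w_scale: "\<And>c x. 0 < c \<Longrightarrow> w (c *\<^sub>R x) = w x" and w_nonneg: "\<And>x. 0 \<le> w x"
    and int: "integrable lborel (\<lambda>x. w x * exp (- q x / 2))"
  shows integrable_quadratic_exp: "integrable lborel (\<lambda>x. w x * exp (- q x / 2) * q x)"
    and integral_quadratic_exp_ge:
      "DIM('a) * (\<integral>x. w x * exp (- q x / 2) \<partial>lborel) \<le> (\<integral>x. w x * exp (- q x / 2) * q x \<partial>lborel)"
proof -
  \<comment> \<open>Dilating by \<open>sqrt (1/2)\<close> halves \<open>q\<close>. The slower decay
    \<open>exp (- q / 4)\<close> is thus integrable too, and it absorbs the factor \<open>q\<close>
    because \<open>q / 4 \<le> exp (q / 4)\<close>.\<close>
  have "integrable lborel (\<lambda>x. w (sqrt (1/2) *\<^sub>R x) * exp (- q (sqrt (1/2) *\<^sub>R x) / 2))"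
    by (rule integrable_scaleR[OF int]) simp
  then have "integrable lborel (\<lambda>x. 4 * (w x * exp (- q x / 4)))"
    by (simp add: q_scale w_scale)
  then show int': "integrable lborel (\<lambda>x. w x * exp (- q x / 2) * q x)"
  proof (rule Bochner_Integration.integrable_bound)
    show "AE x in lborel. norm (w x * exp (- q x / 2) * q x) \<le> norm (4 * (w x * exp (- q x / 4)))"
    proof (intro AE_I2)
      fix x
      have "q x / 4 \<le> exp (q x / 4)"
        using exp_ge_add_one_self[of "q x / 4"] by linarith
      then have "exp (- q x / 2) * q x \<le> exp (- q x / 2) * (4 * exp (q x / 4))"
        by (intro mult_left_mono) auto
      also have "\<dots> = 4 * exp (- q x / 4)"
        by (simp flip: exp_add)
      finally have "w x * (exp (- q x / 2) * q x) \<le> w x * (4 * exp (- q x / 4))"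
        by (intro mult_left_mono w_nonneg)
      then show "norm (w x * exp (- q x / 2) * q x) \<le> norm (4 * (w x * exp (- q x / 4)))"
        by (simp add: abs_mult q_nonneg w_nonneg mult_ac)
    qed
  qed simp
  define Z where "Z = (\<integral>x. w x * exp (- q x / 2) \<partial>lborel)"
  define I where "I = (\<integral>x. w x * exp (- q x / 2) * q x \<partial>lborel)"
  define d where "d = DIM('a)"
  have Z: "0 \<le> Z"
    unfolding Z_def by (intro Bochner_Integration.integral_nonneg) (simp add: w_nonneg)
  have *: "2 * d * Z \<le> I * (2 + h) * (1 + d * h)" if h: "0 < h" for h :: real
  proof -
    define c where "c = 1 + h"
    have c: "0 < c" using h by (simp add: c_def)
    have "integrable lborel (\<lambda>x. w (c *\<^sub>R x) * exp (- q (c *\<^sub>R x) / 2))"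
      by (rule integrable_scaleR[OF int c])
    then have intc: "integrable lborel (\<lambda>x. w x * exp (- (c\<^sup>2 * q x) / 2))"
      using c by (simp add: q_scale w_scale)
    have "Z - (c\<^sup>2 - 1) / 2 * I
        = (\<integral>x. w x * exp (- q x / 2) - (c\<^sup>2 - 1) / 2 * (w x * exp (- q x / 2) * q x) \<partial>lborel)"
      using int int' by (simp add: Z_def I_def)
    also have "\<dots> \<le> (\<integral>x. w x * exp (- (c\<^sup>2 * q x) / 2) \<partial>lborel)"
    proof (rule integral_mono)
      fix x
      have "w x * exp (- q x / 2) - (c\<^sup>2 - 1) / 2 * (w x * exp (- q x / 2) * q x)
          = w x * exp (- q x / 2) * (1 + (- (c\<^sup>2 - 1) / 2 * q x))"
        by (simp add: field_simps)
      also have "\<dots> \<le> w x * exp (- q x / 2) * exp (- (c\<^sup>2 - 1) / 2 * q x)"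
        by (intro mult_left_mono exp_ge_add_one_self) (simp add: w_nonneg)
      also have "\<dots> = w x * exp (- (c\<^sup>2 * q x) / 2)"
        by (simp add: mult.assoc field_simps flip: exp_add)
      finally show "w x * exp (- q x / 2) - (c\<^sup>2 - 1) / 2 * (w x * exp (- q x / 2) * q x)
          \<le> w x * exp (- (c\<^sup>2 * q x) / 2)" .
    qed (use int int' intc in auto)
    finally have "c ^ d * (Z - (c\<^sup>2 - 1) / 2 * I) \<le> c ^ d * (\<integral>x. w x * exp (- (c\<^sup>2 * q x) / 2) \<partial>lborel)"
      using c by (intro mult_left_mono) auto
    \<comment> \<open>\<open>c ^ d\<close> is the Jacobian of the dilation by \<open>c\<close>,
      which leaves \<open>w\<close> unchanged.\<close>
    also have "\<dots> = Z"
      unfolding Z_def d_def using c by (subst integral_scaleR[OF _ c]) (auto simp: q_scale w_scale)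
    finally have 1: "(c ^ d - 1) * Z \<le> c ^ d * ((c\<^sup>2 - 1) / 2 * I)"
      by (simp add: field_simps)
    \<comment> \<open>Bernoulli's inequality replaces \<open>c ^ d\<close> by a linear term, so that
      \<open>b - 1 = d * h\<close> and \<open>c\<^sup>2 - 1 = h * (2 + h)\<close> share the factor
      \<open>h\<close>, which cancels before the limit.\<close>
    define b where "b = 1 + d * h"
    have b: "0 < b" "b \<le> c ^ d"
      using h Bernoulli_inequality[of h d] by (auto simp: b_def c_def add_pos_nonneg)
    have "(1 - 1 / b) * Z \<le> (1 - 1 / c ^ d) * Z"
      using b Z c by (intro mult_right_mono) (auto simp: field_simps)
    also have "\<dots> \<le> (c\<^sup>2 - 1) / 2 * I"
      using 1 c by (simp add: field_simps)
    finally have "(b - 1) * Z \<le> (c\<^sup>2 - 1) / 2 * I * b"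
      using b by (simp add: field_simps)
    then have "h * (2 * d * Z) \<le> h * (I * (2 + h) * b)"
      by (simp add: b_def c_def power2_eq_square algebra_simps)
    then show ?thesis using h by (simp add: b_def)
  qed
  have "2 * d * Z \<le> I * 2 * 1"
  proof (rule tendsto_lowerbound)
    show "((\<lambda>h::real. I * (2 + h) * (1 + d * h)) \<longlongrightarrow> I * 2 * 1) (at_right 0)"
      by (auto intro!: tendsto_eq_intros)
    show "\<forall>\<^sub>F h::real in at_right 0. 2 * d * Z \<le> I * (2 + h) * (1 + d * h)"
      using * by (auto simp: eventually_at_right_field intro: exI[of _ 1])
  qed auto
  then show "DIM('a) * (\<integral>x. w x * exp (- q x / 2) \<partial>lborel) \<le> (\<integral>x. w x * exp (- q x / 2) * q x \<partial>lborel)"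
    by (simp add: Z_def I_def d_def)
qed

section \<open>Product integrals and one-dimensional Gaussians\<close>

text \<open>Tonelli's theorem over \<open>Basis\<close>, transported to the index type along the
  bijection \<open>i \<mapsto> axis i 1\<close>.\<close>

lemma nn_integral_lborel_vec_prod:
  fixes f :: "'n::finite \<Rightarrow> real \<Rightarrow> ennreal"
  assumes [measurable]: "\<And>i. f i \<in> borel_measurable borel"
  shows "(\<integral>\<^sup>+x. (\<Prod>i\<in>UNIV. f i (x $ i)) \<partial>lborel) = (\<Prod>i\<in>UNIV. \<integral>\<^sup>+y. f i y \<partial>lborel)"
proof -
  define e :: "'n \<Rightarrow> real ^ 'n" where "e i = axis i 1" for i
  have inj: "inj e"
    by (auto simp: inj_on_def e_def axis_eq_axis)
  have Basis: "Basis = range e"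
    by (auto simp: Basis_vec_def e_def)
  have "(\<integral>\<^sup>+x. (\<Prod>b\<in>Basis. f (inv e b) (x \<bullet> b)) \<partial>lborel) = (\<Prod>b\<in>Basis. (\<integral>\<^sup>+y. f (inv e b) y \<partial>lborel))"
    by (rule nn_integral_lborel_prod) auto
  then show ?thesis
    using inj by (simp add: Basis prod.reindex e_def[symmetric] cart_eq_inner_axis)
qed

text \<open>The reflection \<open>y \<mapsto> - y\<close> exchanges the two open half-lines, and the
  origin is a null set.\<close>

lemma nn_integral_even_halfline:
  fixes f :: "real \<Rightarrow> ennreal"
  assumes [measurable]: "f \<in> borel_measurable borel" and even: "\<And>y. f (- y) = f y"
  shows "(\<integral>\<^sup>+y. f y \<partial>lborel) = 2 * (\<integral>\<^sup>+y. indicator {0<..} y * f y \<partial>lborel)"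
proof -
  have "(\<integral>\<^sup>+y. f y \<partial>lborel) = (\<integral>\<^sup>+y. indicator {0<..} y * f y + indicator {..<0} y * f y \<partial>lborel)"
    using AE_lborel_singleton[of "0::real"]
    by (intro nn_integral_cong_AE) (auto split: split_indicator elim!: eventually_mono)
  also have "\<dots> = (\<integral>\<^sup>+y. indicator {0<..} y * f y \<partial>lborel) + (\<integral>\<^sup>+y. indicator {..<0} y * f y \<partial>lborel)"
    by (rule nn_integral_add) auto
  also have "(\<integral>\<^sup>+y. indicator {..<0} y * f y \<partial>lborel) = (\<integral>\<^sup>+y. indicator {0<..} y * f y \<partial>lborel)"
    by (subst nn_integral_real_affine[where c = "-1" and t = 0])
       (auto simp: even split: split_indicator intro!: nn_integral_cong)
  finally show ?thesis
    by (simp add: mult_2)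
qed

text \<open>Up to the factor \<open>sqrt (2 * pi / a)\<close> the integrand is the normal density of
  variance \<open>1 / a\<close>.\<close>

lemma nn_integral_gaussian_finite:
  fixes a :: real
  assumes "0 < a"
  shows "(\<integral>\<^sup>+y. ennreal (exp (- (a * y\<^sup>2) / 2)) \<partial>lborel) < \<infinity>"
proof -
  have "integrable lborel (\<lambda>y. sqrt (2 * pi / a) * normal_density 0 (1 / sqrt a) y)"
    using assms by (intro integrable_mult_right integrable_normal_density) auto
  also have "(\<lambda>y. sqrt (2 * pi / a) * normal_density 0 (1 / sqrt a) y) = (\<lambda>y. exp (- (a * y\<^sup>2) / 2))"
    using assms by (auto simp: normal_density_def power_divide fun_eq_iff)
  finally show ?thesis
    by (simp add: integrable_iff_bounded)
qed


section \<open>Gaussians with a diagonal quadratic form\<close>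

lemma borel_measurable_vec_nth [measurable]: "(\<lambda>x::real ^ 'n. x $ i) \<in> borel_measurable borel"
  by (intro borel_measurable_continuous_onI continuous_intros)

lemma measurable_positive_orthant [measurable]: "(positive_orthant :: (real ^ 'n) set) \<in> sets borel"
  unfolding positive_orthant_def by measurable

definition diag_form :: "('n \<Rightarrow> real) \<Rightarrow> real ^ 'n \<Rightarrow> real" where
  "diag_form a x = (\<Sum>i\<in>UNIV. a i * (x $ i)\<^sup>2)"

lemma diag_form_measurable [measurable]: "diag_form a \<in> borel_measurable borel"
  unfolding diag_form_def by measurable

lemma diag_form_scaleR: "diag_form a (c *\<^sub>R x) = c\<^sup>2 * diag_form a x"
  by (simp add: diag_form_def power_mult_distrib sum_distrib_left mult_ac)

lemma diag_form_nonneg: "(\<And>i. 0 < a i) \<Longrightarrow> 0 \<le> diag_form a x"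
  unfolding diag_form_def by (intro sum_nonneg) (simp add: less_imp_le)

lemma square_le_diag_form:
  assumes "\<And>i. 0 < a i"
  shows "(x $ i)\<^sup>2 \<le> diag_form a x / a i"
proof -
  have "a i * (x $ i)\<^sup>2 \<le> diag_form a x"
    unfolding diag_form_def using assms by (intro member_le_sum) (auto simp: less_imp_le)
  then show ?thesis
    using assms[of i] by (simp add: field_simps)
qed

text \<open>The Gaussian factors into even functions of single coordinates, and so does the orthant
  indicator. Each of the \<open>CARD('n)\<close> half-lines carries half of its one-dimensional
  integral.\<close>

lemma
  fixes a :: "'n::finite \<Rightarrow> real"
  assumes a: "\<And>i. 0 < a i"
  shows integrable_diag_gaussian: "integrable lborel (\<lambda>x. exp (- diag_form a x / 2))"
    and integral_diag_gaussian_orthant: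
      "(\<integral>x. indicator positive_orthant x * exp (- diag_form a x / 2) \<partial>lborel)
         = (1 / 2) ^ CARD('n) * (\<integral>x. exp (- diag_form a x / 2) \<partial>lborel)"
proof -
  define f where "f i y = ennreal (exp (- (a i * y\<^sup>2) / 2))" for i y
  have f [measurable]: "f i \<in> borel_measurable borel" for i
    unfolding f_def by measurable
  define J where "J i = (\<integral>\<^sup>+y. indicator {0<..} y * f i y \<partial>lborel)" for i
  have prod_f: "ennreal (exp (- diag_form a x / 2)) = (\<Prod>i\<in>UNIV. f i (x $ i))" for x
    by (simp add: f_def prod_ennreal diag_form_def sum_divide_distrib flip: exp_sum sum_negf)
  have J: "(\<integral>\<^sup>+y. f i y \<partial>lborel) = 2 * J i" for i
    unfolding J_def by (rule nn_integral_even_halfline) (auto simp: f_def)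
  have whole: "(\<integral>\<^sup>+x. ennreal (exp (- diag_form a x / 2)) \<partial>lborel) = (\<Prod>i\<in>UNIV. 2 * J i)"
    unfolding prod_f by (simp add: nn_integral_lborel_vec_prod J)
  have "(\<integral>\<^sup>+y. f i y \<partial>lborel) < \<infinity>" for i
    unfolding f_def by (rule nn_integral_gaussian_finite) (rule a)
  then have "(\<Prod>i\<in>UNIV. 2 * J i) \<noteq> top"
    by (simp add: J ennreal_prod_eq_top less_top del: prod.distrib)
  then have "(\<integral>\<^sup>+x. ennreal (exp (- diag_form a x / 2)) \<partial>lborel) < \<infinity>"
    unfolding whole by (simp add: less_top)
  then show int: "integrable lborel (\<lambda>x. exp (- diag_form a x / 2))"
    by (simp add: integrable_iff_bounded)
  have ind: "indicator positive_orthant x = (\<Prod>i\<in>UNIV. indicator {0<..} (x $ i) :: ennreal)" for x :: "real ^ 'n"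
    by (cases "x \<in> positive_orthant") (auto simp: positive_orthant_def indicator_def intro!: prod_zero[symmetric])
  have "(\<integral>\<^sup>+x. indicator positive_orthant x * ennreal (exp (- diag_form a x / 2)) \<partial>lborel)
      = (\<integral>\<^sup>+x. (\<Prod>i\<in>UNIV. indicator {0<..} (x $ i) * f i (x $ i)) \<partial>lborel)"
    unfolding ind prod_f by (simp add: prod.distrib)
  also have "\<dots> = (\<Prod>i\<in>UNIV. J i)"
    unfolding J_def by (rule nn_integral_lborel_vec_prod) measurable
  finally have half: "(\<integral>\<^sup>+x. ennreal (indicator positive_orthant x * exp (- diag_form a x / 2)) \<partial>lborel) = (\<Prod>i\<in>UNIV. J i)"
    by (simp add: ennreal_mult' ennreal_indicator)
  have "(\<integral>x. exp (- diag_form a x / 2) \<partial>lborel) = enn2real (\<Prod>i\<in>UNIV. 2 * J i)"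
    by (subst integral_eq_nn_integral) (use whole in auto)
  also have "\<dots> = 2 ^ CARD('n) * enn2real (\<Prod>i\<in>UNIV. J i)"
    by (simp add: prod.distrib enn2real_mult flip: ennreal_numeral ennreal_power)
  also have "enn2real (\<Prod>i\<in>UNIV. J i) = (\<integral>x. indicator positive_orthant x * exp (- diag_form a x / 2) \<partial>lborel)"
    by (subst integral_eq_nn_integral) (use half in auto)
  finally show "(\<integral>x. indicator positive_orthant x * exp (- diag_form a x / 2) \<partial>lborel)
         = (1 / 2) ^ CARD('n) * (\<integral>x. exp (- diag_form a x / 2) \<partial>lborel)"
    by (simp add: power_divide)
qed

text \<open>Changing the sign of one coordinate is a diagonal linear map whose Jacobian has absolute
  value \<open>1\<close>.\<close>

lemma integral_reflect_coordinate:
  fixes f :: "real ^ 'n \<Rightarrow> real"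
  assumes [measurable]: "f \<in> borel_measurable borel"
  shows "(\<integral>x. f (\<chi> k. if k = i then - x $ k else x $ k) \<partial>lborel) = (\<integral>x. f x \<partial>lborel)"
proof -
  define c :: "real ^ 'n \<Rightarrow> real" where "c b = (if b = axis i 1 then -1 else 1)" for b
  \<comment> \<open>The leading \<open>0 +\<close> is the zero translation that
    \<open>lborel_affine_euclidean\<close> expects.\<close>
  define T where "T x = 0 + (\<Sum>b\<in>Basis. (c b * (x \<bullet> b)) *\<^sub>R b)" for x :: "real ^ 'n"
  have T: "T x = (\<chi> k. if k = i then - x $ k else x $ k)" for x
  proof (rule vec_eq_iff[THEN iffD2], rule allI)
    fix k
    have "T x $ k = T x \<bullet> axis k 1"
      by (simp add: inner_axis)
    also have "\<dots> = c (axis k 1) * (x \<bullet> axis k 1)"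
      unfolding T_def by (simp add: inner_sum_left axis_in_Basis_iff inner_Basis sum.delta if_distrib cong: if_cong)
    finally show "T x $ k = (\<chi> k. if k = i then - x $ k else x $ k) $ k"
      by (simp add: c_def axis_eq_axis inner_axis)
  qed
  have [measurable]: "T \<in> borel \<rightarrow>\<^sub>M borel"
    unfolding T_def by measurable
  have "(lborel :: (real ^ 'n) measure) = density (distr lborel borel T) (\<lambda>_. (\<Prod>b\<in>Basis. \<bar>c b\<bar>))"
    unfolding T_def by (rule lborel_affine_euclidean) (simp add: c_def)
  also have "(\<Prod>b\<in>Basis. \<bar>c b\<bar>) = 1"
    by (intro prod.neutral) (simp add: c_def)
  finally have "(lborel :: (real ^ 'n) measure) = distr lborel borel T"
    by (simp add: density_1)
  then have "(\<integral>x. f x \<partial>lborel) = (\<integral>x. f x \<partial>distr lborel borel T)"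
    by simp
  also have "\<dots> = (\<integral>x. f (T x) \<partial>lborel)"
    by (rule integral_distr) auto
  finally show ?thesis
    by (simp add: T)
qed

text \<open>For integrability, \<open>\<bar>x $ i * x $ j\<bar>\<close> is at most a multiple of
  \<open>diag_form a x\<close>, whose Gaussian moment is finite by
  \<open>integrable_quadratic_exp\<close> with weight \<open>1\<close>.\<close>

lemma
  fixes a :: "'n::finite \<Rightarrow> real"
  assumes a: "\<And>i. 0 < a i"
  shows integrable_diag_gaussian_mixed: "integrable lborel (\<lambda>x. exp (- diag_form a x / 2) * (x $ i * x $ j))"
    and integral_diag_gaussian_mixed: "i \<noteq> j \<Longrightarrow> (\<integral>x. exp (- diag_form a x / 2) * (x $ i * x $ j) \<partial>lborel) = 0"
proof -
  have "integrable lborel (\<lambda>x. 1 * exp (- diag_form a x / 2) * diag_form a x)"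
    using a integrable_diag_gaussian[of a]
    by (intro integrable_quadratic_exp) (auto simp: diag_form_scaleR diag_form_nonneg)
  then have "integrable lborel (\<lambda>x. (1 / a i + 1 / a j) * (exp (- diag_form a x / 2) * diag_form a x))"
    by simp
  then show "integrable lborel (\<lambda>x. exp (- diag_form a x / 2) * (x $ i * x $ j))"
  proof (rule Bochner_Integration.integrable_bound, measurable, intro AE_I2)
    fix x :: "real ^ 'n"
    have "\<bar>x $ i * x $ j\<bar> \<le> (x $ i)\<^sup>2 + (x $ j)\<^sup>2"
      using sum_squares_bound[of "x $ i" "x $ j"] sum_squares_bound[of "- x $ i" "x $ j"]
      by simp
    also have "\<dots> \<le> (1 / a i + 1 / a j) * diag_form a x"
      using square_le_diag_form[of a x i, OF a] square_le_diag_form[of a x j, OF a] by (simp add: algebra_simps)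
    finally have "exp (- diag_form a x / 2) * \<bar>x $ i * x $ j\<bar>
        \<le> exp (- diag_form a x / 2) * ((1 / a i + 1 / a j) * diag_form a x)"
      by (intro mult_left_mono) auto
    also have "\<dots> \<le> \<bar>(1 / a i + 1 / a j) * (exp (- diag_form a x / 2) * diag_form a x)\<bar>"
      by (simp add: mult_ac)
    finally show "norm (exp (- diag_form a x / 2) * (x $ i * x $ j))
        \<le> norm ((1 / a i + 1 / a j) * (exp (- diag_form a x / 2) * diag_form a x))"
      by (simp add: abs_mult)
  qed
  assume ij: "i \<noteq> j"
  define g where "g x = exp (- diag_form a x / 2) * (x $ i * x $ j)" for x
  \<comment> \<open>Reflecting coordinate \<open>i\<close> fixes every square but changes the sign
    of \<open>x $ i * x $ j\<close>, so the integral equals its own negative.\<close>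
  define R where "R x = (\<chi> k. if k = i then - x $ k else x $ k)" for x :: "real ^ 'n"
  have "diag_form a (R x) = diag_form a x" for x
    unfolding diag_form_def R_def by (intro sum.cong) auto
  then have "g (R x) = - g x" for x
    using ij by (simp add: g_def) (simp add: R_def)
  moreover have "(\<integral>x. g (R x) \<partial>lborel) = (\<integral>x. g x \<partial>lborel)"
    unfolding R_def by (rule integral_reflect_coordinate) (unfold g_def, measurable)
  ultimately show "(\<integral>x. exp (- diag_form a x / 2) * (x $ i * x $ j) \<partial>lborel) = 0"
    by (simp add: g_def)
qed


section \<open>Quadratic forms of inverse covariance matrices\<close>

abbreviation quadratic_form :: "real ^ 'n ^ 'n \<Rightarrow> real ^ 'n \<Rightarrow> real" where
  "quadratic_form A x \<equiv> x \<bullet> (A *v x)"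

lemma quadratic_form_sum: "quadratic_form A x = (\<Sum>i\<in>UNIV. \<Sum>j\<in>UNIV. A $ i $ j * (x $ i * x $ j))"
  by (simp add: inner_vec_def matrix_vector_mult_def sum_distrib_left mult_ac)

lemma quadratic_form_measurable [measurable]: "quadratic_form A \<in> borel_measurable borel"
  unfolding quadratic_form_sum by measurable

lemma quadratic_form_scaleR: "quadratic_form A (c *\<^sub>R x) = c\<^sup>2 * quadratic_form A x"
  by (simp add: matrix_vector_mult_scaleR power2_eq_square)

lemma symmetric_matrix_inner:
  fixes S :: "real ^ 'n ^ 'n"
  shows "transpose S = S \<Longrightarrow> x \<bullet> (S *v y) = (S *v x) \<bullet> y"
  by (metis dot_lmul_matrix transpose_matrix_vector)

text \<open>Positive definiteness makes the kernel of \<open>S\<close> trivial, hence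
  \<open>S\<close> invertible. As \<open>matrix_inv\<close> is a choice operator, a two-sided
  inverse must be exhibited before its property is available.\<close>

lemma sym_pos_def_matrix_inv:
  assumes "sym_pos_def S"
  shows "S *v (matrix_inv S *v x) = x" and "matrix_inv S *v (S *v x) = x"
proof -
  have "\<exists>B. B ** S = mat 1"
    unfolding matrix_left_invertible_ker using assms by (force simp: sym_pos_def_def)
  then have "\<exists>B. S ** B = mat 1 \<and> B ** S = mat 1"
    by (metis matrix_left_right_inverse)
  then have "S ** matrix_inv S = mat 1 \<and> matrix_inv S ** S = mat 1"
    unfolding matrix_inv_def by (rule someI_ex)
  then show "S *v (matrix_inv S *v x) = x" "matrix_inv S *v (S *v x) = x"
    by (simp_all add: matrix_vector_mul_assoc)
qed

text \<open>Substituting \<open>x = S *v y\<close> turns the form of the inverse into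
  \<open>y \<bullet> (S *v y)\<close>.\<close>

lemma quadratic_form_inv_pos:
  assumes S: "sym_pos_def S" and x: "x \<noteq> 0"
  shows "0 < quadratic_form (matrix_inv S) x"
proof -
  define y where "y = matrix_inv S *v x"
  have x_eq: "x = S *v y"
    using sym_pos_def_matrix_inv[OF S] by (simp add: y_def)
  have "y \<noteq> 0"
    using x by (auto simp: x_eq)
  then have "0 < y \<bullet> (S *v y)"
    using S by (simp add: sym_pos_def_def)
  then show ?thesis
    by (simp add: y_def[symmetric] x_eq[symmetric] inner_commute)
qed

lemma quadratic_form_inv_nonneg: "sym_pos_def S \<Longrightarrow> 0 \<le> quadratic_form (matrix_inv S) x"
  using quadratic_form_inv_pos[of S x] by (cases "x = 0") auto

text \<open>A diagonal entry is the value of the form at a unit vector. Its positivity makes the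
  diagonal Gaussian integrable.\<close>

lemma matrix_inv_diag_pos:
  assumes S: "sym_pos_def S"
  shows "0 < matrix_inv S $ i $ i"
proof -
  have "quadratic_form (matrix_inv S) (axis i 1) = matrix_inv S $ i $ i"
    by (simp add: inner_axis' matrix_vector_mult_basis column_def)
  then show ?thesis
    using quadratic_form_inv_pos[OF S, of "axis i 1"] by simp
qed

text \<open>Cauchy--Schwarz for the inner product given by the inverse of \<open>S\<close>, applied to \<open>x\<close> and \<open>S e\<^sub>i\<close>.\<close>

lemma square_le_quadratic_form_inv:
  assumes S: "sym_pos_def S"
  shows "(x $ i)\<^sup>2 \<le> S $ i $ i * quadratic_form (matrix_inv S) x"
proof -
  define e :: "real ^ 'a" where "e = axis i 1"
  define s where "s = S $ i $ i"
  \<comment> \<open>The coefficient of the orthogonal projection of \<open>x\<close> onto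
    \<open>S *v e\<close>: their inner product is \<open>x $ i\<close>, and the squared length of
    \<open>S *v e\<close> is \<open>s\<close>.\<close>
  define t where "t = x $ i / s"
  let ?A = "matrix_inv S"
  have e: "e \<bullet> y = y $ i" "y \<bullet> e = y $ i" for y
    by (simp_all add: e_def inner_axis inner_axis')
  have Se: "(S *v e) $ i = s"
    by (simp add: e_def s_def matrix_vector_mult_basis column_def)
  have "0 < e \<bullet> (S *v e)"
    using S by (auto simp: sym_pos_def_def e_def)
  then have s: "0 < s"
    by (simp add: e Se)
  have 1: "(S *v e) \<bullet> (?A *v x) = x $ i"
    using S sym_pos_def_matrix_inv[OF S]
    by (simp add: sym_pos_def_def e flip: symmetric_matrix_inner)
  have "0 \<le> quadratic_form ?A (x - t *\<^sub>R (S *v e))"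
    by (rule quadratic_form_inv_nonneg[OF S])
  also have "\<dots> = quadratic_form ?A x - 2 * t * x $ i + t\<^sup>2 * s"
    using 1 by (simp add: matrix_vector_mult_diff_distrib matrix_vector_mult_scaleR sym_pos_def_matrix_inv[OF S]
      inner_diff_left inner_diff_right e Se power2_eq_square algebra_simps)
  finally show ?thesis
    using s unfolding s_def[symmetric] t_def by (simp add: field_simps power2_eq_square)
qed

section \<open>Hadamard's inequality for Gaussian integrals\<close>

text \<open>A nonnegative function with integral zero vanishes almost everywhere, whereas
  \<open>exp\<close> never vanishes and the whole space is not null.\<close>

lemma integral_exp_pos:
  fixes u :: "'a::euclidean_space \<Rightarrow> real"
  assumes "integrable lborel (\<lambda>x. exp (u x))"
  shows "0 < (\<integral>x. exp (u x) \<partial>lborel)"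
proof -
  have "(\<integral>x. exp (u x) \<partial>lborel) \<noteq> 0"
    using assms by (subst integral_nonneg_eq_0_iff_AE) (auto simp: AE_iff_null null_sets_def)
  moreover have "0 \<le> (\<integral>x. exp (u x) \<partial>lborel)"
    by (intro Bochner_Integration.integral_nonneg) simp
  ultimately show ?thesis by linarith
qed

text \<open>This is \<open>det A \<le> \<Prod>\<^sub>i A\<^sub>i\<^sub>i\<close>, since a Gaussian integral is proportional to \<open>1 / sqrt (det A)\<close>.\<close>

lemma gaussian_integral_hadamard:
  fixes A :: "real ^ 'n ^ 'n"
  assumes a: "\<And>i. 0 < A $ i $ i"
    and int: "integrable lborel (\<lambda>x. exp (- quadratic_form A x / 2))"
  shows "(\<integral>x. exp (- diag_form (\<lambda>i. A $ i $ i) x / 2) \<partial>lborel) \<le> (\<integral>x. exp (- quadratic_form A x / 2) \<partial>lborel)"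
proof -
  let ?D = "diag_form (\<lambda>i. A $ i $ i)"
  have diff: "?D x - quadratic_form A x = (\<Sum>i\<in>UNIV. \<Sum>j\<in>UNIV - {i}. - A $ i $ j * (x $ i * x $ j))" for x
    unfolding diag_form_def quadratic_form_sum sum_subtractf[symmetric]
  proof (intro sum.cong refl)
    fix i
    show "A $ i $ i * (x $ i)\<^sup>2 - (\<Sum>j\<in>UNIV. A $ i $ j * (x $ i * x $ j))
        = (\<Sum>j\<in>UNIV - {i}. - A $ i $ j * (x $ i * x $ j))"
      by (subst sum.remove[of UNIV i]) (auto simp: sum_negf power2_eq_square)
  qed
  \<comment> \<open>The left side has the literal shape of Gibbs' inequality with weight
    \<open>1\<close>, \<open>u = - ?D / 2\<close> and \<open>v = - Q / 2\<close>. Only mixed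
    products remain on the right, so the exponent in that inequality is zero.\<close>
  have eq: "1 * exp (- ?D x / 2) * (- quadratic_form A x / 2 - - ?D x / 2)
      = (\<Sum>i\<in>UNIV. \<Sum>j\<in>UNIV - {i}. - A $ i $ j / 2 * (exp (- ?D x / 2) * (x $ i * x $ j)))" for x
  proof -
    have "1 * exp (- ?D x / 2) * (- quadratic_form A x / 2 - - ?D x / 2) = exp (- ?D x / 2) / 2 * (?D x - quadratic_form A x)"
      by (simp add: field_simps)
    then show ?thesis
      unfolding diff by (simp add: sum_distrib_left mult_ac)
  qed
  note mixed = integrable_diag_gaussian_mixed[of "\<lambda>i. A $ i $ i", OF a] integral_diag_gaussian_mixed[of "\<lambda>i. A $ i $ i", OF a]
  have int': "integrable lborel (\<lambda>x. 1 * exp (- ?D x / 2) * (- quadratic_form A x / 2 - - ?D x / 2))"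
    unfolding eq by (intro Bochner_Integration.integrable_sum integrable_mult_right mixed)
  have "(\<integral>x. 1 * exp (- ?D x / 2) * (- quadratic_form A x / 2 - - ?D x / 2) \<partial>lborel) = 0"
    unfolding eq using mixed by (simp add: Bochner_Integration.integral_sum)
  then show ?thesis
    using weighted_gibbs_inequality[of "\<lambda>_. 1" lborel "\<lambda>x. - ?D x / 2" "\<lambda>x. - quadratic_form A x / 2"]
      int int' integrable_diag_gaussian[of "\<lambda>i. A $ i $ i", OF a] integral_exp_pos[of "\<lambda>x. - ?D x / 2"]
    by simp
qed


section \<open>Conditional expectations as integrals of the density\<close>

text \<open>Conditioning on \<open>E\<close> gives \<open>M\<close> the density
  \<open>indicator E / measure M E\<close>. Since \<open>E\<close> is a preimage under
  \<open>X\<close>, the integral passes to the law of \<open>X\<close>.\<close>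

lemma expectation_given_distributed:
  fixes X :: "'a \<Rightarrow> real ^ 'n" and f \<phi> :: "real ^ 'n \<Rightarrow> real"
  assumes "prob_space M" and dist: "distributed M lborel X (\<lambda>x. ennreal (\<phi> x))"
    and nonneg: "\<And>x. 0 \<le> \<phi> x"
    and S [measurable]: "S \<in> sets borel" and f [measurable]: "f \<in> borel_measurable borel"
  defines "E \<equiv> {\<omega> \<in> space M. X \<omega> \<in> S}"
  assumes pos: "0 < measure M E"
  shows "expectation_given M (\<lambda>\<omega>. f (X \<omega>)) E
      = (\<integral>x. \<phi> x * (indicator S x * f x) \<partial>lborel) / measure M E"
proof -
  interpret prob_space M by fact
  have X [measurable]: "X \<in> M \<rightarrow>\<^sub>M borel"
    using distributed_measurable[OF dist] by simp
  have E [measurable]: "E \<in> sets M"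
    unfolding E_def by measurable
  have dens: "uniform_measure M E = density M (\<lambda>\<omega>. ennreal (indicator E \<omega> / measure M E))"
    unfolding uniform_measure_def
    by (rule arg_cong[where f = "density M"])
       (use pos in \<open>auto simp: fun_eq_iff emeasure_eq_measure divide_ennreal split: split_indicator simp flip: ennreal_1\<close>)
  have "expectation_given M (\<lambda>\<omega>. f (X \<omega>)) E = (\<integral>\<omega>. indicator E \<omega> / measure M E * f (X \<omega>) \<partial>M)"
    unfolding expectation_given_def dens by (subst integral_density) auto
  also have "\<dots> = (\<integral>\<omega>. (indicator S (X \<omega>) * f (X \<omega>)) / measure M E \<partial>M)"
    by (intro Bochner_Integration.integral_cong) (auto simp: E_def split: split_indicator)
  also have "\<dots> = (\<integral>\<omega>. indicator S (X \<omega>) * f (X \<omega>) \<partial>M) / measure M E"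
    by simp
  also have "(\<integral>\<omega>. indicator S (X \<omega>) * f (X \<omega>) \<partial>M) = (\<integral>x. \<phi> x * (indicator S x * f x) \<partial>lborel)"
    by (rule distributed_integral[OF dist, symmetric]) (auto simp: nonneg)
  finally show ?thesis .
qed

section \<open>The bound for the orthant probability\<close>

theorem theorem4:
  fixes M :: "'a measure"
    and X :: "'a \<Rightarrow> real ^ 'd"
    and \<Sigma> :: "real ^ 'd ^ 'd"
  assumes "prob_space M"
    and "sym_pos_def \<Sigma>"
    and "multivariate_normal M X 0 \<Sigma>"
  defines "E \<equiv> {\<omega> \<in> space M. X \<omega> \<in> positive_orthant}"
  shows "measure M E
           \<le> exp (1 / 2 * (\<Sum>i\<in>UNIV. matrix_inv \<Sigma> $ i $ i * expectation_given M (\<lambda>\<omega>. (X \<omega> $ i)\<^sup>2) E))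
             / (2 ^ (CARD('d) - 1) * exp (real CARD('d) / 2))
         \<and> ((\<forall>i. matrix_inv \<Sigma> $ i $ i = 1) \<longrightarrow>
           measure M E
             \<le> 2 powr (- real CARD('d) + 1) * exp (- (real CARD('d) / 2))
               * exp (1 / 2 * expectation_given M (\<lambda>\<omega>. (norm (X \<omega>))\<^sup>2) E))"
proof (cases "measure M E = 0")
  \<comment> \<open>On a null event the conditional expectations are junk, but both right-hand sides
    are nonnegative whatever their values.\<close>
  case True
  then show ?thesis by simp
next
  case False
  interpret prob_space M by fact
  define A where "A = matrix_inv \<Sigma>"
  define p where "p = measure M E"
  define K where "K = sqrt ((2 * pi) ^ CARD('d) * det \<Sigma>)"
  define \<phi> where "\<phi> x = exp (- quadratic_form A x / 2) / K" for x
  define w where "w = (indicator positive_orthant :: real ^ 'd \<Rightarrow> real)"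
  define D where "D = diag_form (\<lambda>i. A $ i $ i)"
  let ?g = "\<lambda>x. w x * exp (- quadratic_form A x / 2)"
  define m where "m i = expectation_given M (\<lambda>\<omega>. (X \<omega> $ i)\<^sup>2) E" for i
  define T where "T = (\<Sum>i\<in>UNIV. A $ i $ i * m i)"
  have p: "0 < p"
    using False by (simp add: p_def zero_less_measure_iff)
  have A: "0 < A $ i $ i" for i
    unfolding A_def using assms(2) by (rule matrix_inv_diag_pos)
  have [measurable]: "\<phi> \<in> borel_measurable borel" "w \<in> borel_measurable borel" "D \<in> borel_measurable borel"
    unfolding \<phi>_def w_def D_def by measurable
  have dist: "distributed M lborel X (\<lambda>x. ennreal (\<phi> x))"
    using assms(3) by (simp add: multivariate_normal_def mvn_density_def[abs_def] \<phi>_def K_def A_def)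
  have total: "(\<integral>\<^sup>+x. ennreal (\<phi> x) \<partial>lborel) = 1"
    using distributed_nn_integral[OF dist, of "\<lambda>_. 1"] by (simp add: emeasure_space_1)
  \<comment> \<open>Positivity is read off from the total mass \<open>1\<close>: for
    \<open>K \<le> 0\<close> the function \<open>\<phi>\<close> would be nowhere positive, division
    by zero giving \<open>0\<close>.\<close>
  have K: "0 < K"
  proof (rule ccontr)
    assume "\<not> 0 < K"
    then have "\<phi> x \<le> 0" for x
      by (simp add: \<phi>_def divide_nonneg_nonpos)
    then have "(\<integral>\<^sup>+x. ennreal (\<phi> x) \<partial>lborel) = 0"
      by (simp add: ennreal_neg)
    with total show False by simp
  qed
  have \<phi>_nonneg: "0 \<le> \<phi> x" for x
    using K by (simp add: \<phi>_def)
  have int_\<phi>: "integrable lborel \<phi>" "(\<integral>x. \<phi> x \<partial>lborel) = 1"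
    using total \<phi>_nonneg by (simp_all add: integrable_iff_bounded integral_eq_nn_integral)
  have exp_eq: "exp (- quadratic_form A x / 2) = K * \<phi> x" for x
    using K by (simp add: \<phi>_def)
  have int_exp: "integrable lborel (\<lambda>x. exp (- quadratic_form A x / 2))"
    unfolding exp_eq using int_\<phi> by simp
  have integral_exp: "(\<integral>x. exp (- quadratic_form A x / 2) \<partial>lborel) = K"
    unfolding exp_eq using int_\<phi> by simp
  have w01: "0 \<le> w x" "w x \<le> 1" for x
    by (simp_all add: w_def indicator_def)
  have w_scale: "w (c *\<^sub>R x) = w x" if "0 < c" for c x
    using that by (simp add: w_def positive_orthant_def indicator_def zero_less_mult_iff)
  have int_w: "integrable lborel (\<lambda>x. ?g x)"
    unfolding w_def using integrable_mult_indicator[OF _ int_exp, of positive_orthant] by simp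
  have given: "expectation_given M (\<lambda>\<omega>. f (X \<omega>)) E
      = (\<integral>x. ?g x * f x \<partial>lborel) / (p * K)"
    if "f \<in> borel_measurable borel" for f
  proof -
    have "expectation_given M (\<lambda>\<omega>. f (X \<omega>)) E = (\<integral>x. \<phi> x * (indicator positive_orthant x * f x) \<partial>lborel) / p"
      unfolding E_def p_def
      by (rule expectation_given_distributed[OF assms(1) dist \<phi>_nonneg _ that])
         (use p in \<open>auto simp: p_def E_def\<close>)
    also have "(\<lambda>x. \<phi> x * (indicator positive_orthant x * f x)) = (\<lambda>x. ?g x * f x / K)"
      by (simp add: \<phi>_def w_def mult_ac)
    finally show ?thesis by (simp add: mult.commute)
  qed
  \<comment> \<open>Conditioning the constant \<open>1\<close> identifies the Gaussian mass of the
    orthant.\<close>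
  have Z: "(\<integral>x. ?g x \<partial>lborel) = p * K"
  proof -
    have "prob_space (uniform_measure M E)"
      using p by (intro prob_space_uniform_measure) (auto simp: p_def emeasure_eq_measure)
    then have "expectation_given M (\<lambda>_. 1) E = 1"
      using prob_space.prob_space[of "uniform_measure M E"] by (simp add: expectation_given_def)
    then show ?thesis
      using given[of "\<lambda>_. 1"] p K by (simp add: field_simps)
  qed
  have q_nonneg: "0 \<le> quadratic_form A x" for x
    unfolding A_def by (rule quadratic_form_inv_nonneg) fact
  note quad = quadratic_form_measurable _ quadratic_form_scaleR q_nonneg w_scale w01(1) int_w
  have int_Q: "integrable lborel (\<lambda>x. ?g x * quadratic_form A x)"
    by (rule integrable_quadratic_exp[OF quad]) auto
  \<comment> \<open>A lower bound is the direction wanted, because the exponent in Gibbs' inequality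
    increases with the mean of \<open>Q\<close>.\<close>
  have Q_ge: "CARD('d) * (p * K) \<le> (\<integral>x. ?g x * quadratic_form A x \<partial>lborel)"
    using integral_quadratic_exp_ge[OF quad] unfolding Z by simp
  have int_sq: "integrable lborel (\<lambda>x. ?g x * (x $ i)\<^sup>2)" for i
  proof (rule Bochner_Integration.integrable_bound)
    \<comment> \<open>The Cauchy-Schwarz bound dominates each squared coordinate by a multiple of
      \<open>Q\<close>, whose moment is already known to be finite.\<close>
    show "integrable lborel (\<lambda>x. \<Sigma> $ i $ i * (?g x * quadratic_form A x))"
      using int_Q by simp
    show "AE x in lborel. norm (?g x * (x $ i)\<^sup>2)
        \<le> norm (\<Sigma> $ i $ i * (?g x * quadratic_form A x))"
    proof (intro AE_I2)
      fix x :: "real ^ 'd"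
      have "?g x * (x $ i)\<^sup>2
          \<le> ?g x * (\<Sigma> $ i $ i * quadratic_form A x)"
        unfolding A_def by (intro mult_left_mono square_le_quadratic_form_inv assms(2)) (simp add: w01)
      also have "\<dots> \<le> norm (\<Sigma> $ i $ i * (?g x * quadratic_form A x))"
        by (simp add: mult_ac)
      finally show "norm (?g x * (x $ i)\<^sup>2)
          \<le> norm (\<Sigma> $ i $ i * (?g x * quadratic_form A x))"
        by (simp add: w01 abs_mult)
    qed
  qed measurable
  have m: "(\<integral>x. ?g x * (x $ i)\<^sup>2 \<partial>lborel) = m i * (p * K)" for i
    using given[of "\<lambda>x. (x $ i)\<^sup>2"] p K by (simp add: m_def)
  have D_eq: "?g x * D x
      = (\<Sum>i\<in>UNIV. A $ i $ i * (?g x * (x $ i)\<^sup>2))" for x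
    by (simp add: D_def diag_form_def sum_distrib_left mult_ac)
  have int_D: "integrable lborel (\<lambda>x. ?g x * D x)"
    unfolding D_eq using int_sq by simp
  have integral_D: "(\<integral>x. ?g x * D x \<partial>lborel) = T * (p * K)"
    unfolding D_eq
    by (subst Bochner_Integration.integral_sum, intro integrable_mult_right int_sq)
       (simp only: integral_mult_right_zero m T_def sum_distrib_right, simp only: mult.assoc)
  \<comment> \<open>Gibbs' inequality now runs from \<open>u = - Q / 2\<close> to
    \<open>v = - D / 2\<close> with the orthant indicator as weight.\<close>
  have uv_eq: "?g x * (- D x / 2 - - quadratic_form A x / 2)
     = (?g x * quadratic_form A x - ?g x * D x) / 2" for x
    by (simp add: field_simps)
  have int_uv: "integrable lborel (\<lambda>x. ?g x * (- D x / 2 - - quadratic_form A x / 2))"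
    unfolding uv_eq using int_Q int_D by simp
  have "(\<integral>x. ?g x * (- D x / 2 - - quadratic_form A x / 2) \<partial>lborel)
      = ((\<integral>x. ?g x * quadratic_form A x \<partial>lborel) - T * (p * K)) / 2"
    unfolding uv_eq integral_divide_zero by (simp only: Bochner_Integration.integral_diff[OF int_Q int_D] integral_D)
  also have "\<dots> \<ge> (CARD('d) * (p * K) - T * (p * K)) / 2"
    using Q_ge by (intro divide_right_mono diff_right_mono) (assumption, simp)
  finally have mean: "(CARD('d) - T) / 2
      \<le> (\<integral>x. ?g x * (- D x / 2 - - quadratic_form A x / 2) \<partial>lborel) / (p * K)"
    (is "_ \<le> ?mean")
    using p K by (subst pos_le_divide_eq) (simp_all add: left_diff_distrib)
  have int_wD: "integrable lborel (\<lambda>x. w x * exp (- D x / 2))"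
    unfolding w_def D_def
    using integrable_mult_indicator[OF _ integrable_diag_gaussian[of "\<lambda>i. A $ i $ i", OF A], of positive_orthant] by simp
  have "p * K * exp ((CARD('d) - T) / 2) \<le> p * K * exp ?mean"
    using mean p K by (intro mult_left_mono) auto
  also have "\<dots> \<le> (\<integral>x. w x * exp (- D x / 2) \<partial>lborel)"
    using weighted_gibbs_inequality[of w, OF w01(1) int_w int_wD int_uv] p K unfolding Z by simp
  also have "\<dots> = (1 / 2) ^ CARD('d) * (\<integral>x. exp (- D x / 2) \<partial>lborel)"
    unfolding w_def D_def by (rule integral_diag_gaussian_orthant) (rule A)
  \<comment> \<open>Hadamard's inequality brings back the same constant \<open>K\<close> that
    multiplies the left end of the chain, so it cancels.\<close>
  also have "\<dots> \<le> (1 / 2) ^ CARD('d) * K"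
    using gaussian_integral_hadamard[OF A int_exp] unfolding D_def integral_exp by (intro mult_left_mono) auto
  finally have "p * exp ((CARD('d) - T) / 2) \<le> (1 / 2) ^ CARD('d)"
    using K by (simp add: mult_ac)
  then have "p * exp ((CARD('d) - T) / 2) * exp ((T - CARD('d)) / 2) \<le> (1 / 2) ^ CARD('d) * exp ((T - CARD('d)) / 2)"
    by (rule mult_right_mono) simp
  then have "p \<le> (1 / 2) ^ CARD('d) * exp ((T - CARD('d)) / 2)"
    by (simp add: mult.assoc diff_divide_distrib flip: exp_add)
  \<comment> \<open>Here a factor \<open>2\<close> is given away to reach the stated
    constant.\<close>
  also have "\<dots> \<le> (1 / 2) ^ (CARD('d) - 1) * exp ((T - CARD('d)) / 2)"
    by (intro mult_right_mono power_decreasing) auto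
  also have "\<dots> = (1 / 2) ^ (CARD('d) - 1) * (exp (- (CARD('d) / 2)) * exp (1 / 2 * T))"
    by (simp add: diff_divide_distrib flip: exp_add)
  finally have bound: "p \<le> (1 / 2) ^ (CARD('d) - 1) * (exp (- (CARD('d) / 2)) * exp (1 / 2 * T))" .
  have "(\<Sum>i\<in>UNIV. m i) = expectation_given M (\<lambda>\<omega>. (norm (X \<omega>))\<^sup>2) E"
  proof -
    have norm_eq: "?g x * (norm x)\<^sup>2 = (\<Sum>i\<in>UNIV. ?g x * (x $ i)\<^sup>2)" for x
      by (simp add: norm_vec_def L2_set_def sum_nonneg sum_distrib_left)
    have "(\<integral>x. ?g x * (norm x)\<^sup>2 \<partial>lborel) = (\<Sum>i\<in>UNIV. m i) * (p * K)"
      unfolding norm_eq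
      by (subst Bochner_Integration.integral_sum, rule int_sq) (simp only: m sum_distrib_right)
    then show ?thesis
      using p K given[of "\<lambda>x. (norm x)\<^sup>2"] by simp
  qed
  \<comment> \<open>The truncated subtraction agrees with the real one because
    \<open>CARD('d)\<close> is at least \<open>1\<close>.\<close>
  moreover have "2 powr (- real CARD('d) + 1) = (1 / 2) ^ (CARD('d) - 1)"
  proof -
    have "- real CARD('d) + 1 = - real (CARD('d) - 1)"
      by (simp add: of_nat_diff)
    then show ?thesis
      by (simp only: powr_minus powr_realpow power_one_over inverse_eq_divide)
  qed
  moreover have "(\<forall>i. A $ i $ i = 1) \<longrightarrow> T = (\<Sum>i\<in>UNIV. m i)"
    by (simp add: T_def)
  ultimately have "(\<forall>i. A $ i $ i = 1) \<longrightarrow>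
      p \<le> 2 powr (- real CARD('d) + 1) * exp (- (CARD('d) / 2))
        * exp (1 / 2 * expectation_given M (\<lambda>\<omega>. (norm (X \<omega>))\<^sup>2) E)"
    using bound by (metis mult.assoc)
  moreover have "p \<le> exp (1 / 2 * T) / (2 ^ (CARD('d) - 1) * exp (CARD('d) / 2))"
  proof -
    have "(1 / 2) ^ k * (exp (- y) * z) = z / (2 ^ k * exp y)" for k :: nat and y z :: real
      by (simp add: exp_minus power_one_over divide_simps)
    with bound show ?thesis by simp
  qed
  ultimately show ?thesis
    unfolding p_def A_def m_def T_def by simp
qed

end
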